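(* For any $\lambda\ge1$ there exists a Borel measure $\mu\ge0$ on $(\partial T)^2$ such that $\mathbb{V}^\mu\le1$ on $\mathrm{supp}\,\mu$, but $\mathbb{V}^\mu(\zeta_0)\ge\lambda$ at some $\zeta_0\in(\partial T)^2$. Moreover, one can take $\mu=\mu_E$ to be the equilibrium measure of some set $E\subseteq(\partial T)^2$.
   Context: $T$ is (the vertex set of) the infinite rooted binary tree with root $o$; $\partial T$ is the set of infinite descending sequences $\omega=(\omega^j)_{j\ge0}$, $\omega^0=o$, $\omega^{j+1}$ a child of $\omega^j$; $\overline{T}=T\cup\partial T$. For $\alpha,\beta\in T$, $\alpha\le\beta$ means that $\beta$ lies on the path from $o$ to $\alpha$; also $\omega\le\omega^j$ for all $j$ and $\omega\le\omega$ when $\omega\in\partial T$. $\overline{T}$ carries its compact metrizable topology given by the metric $\delta_0(\zeta,\xi)=2^{-d(\zeta\wedge\xi)}-\frac12(2^{-d(\zeta)}+2^{-d(\xi)})$, where $d(\zeta\wedge\xi)\in[1,\infty]$ is the number of common ancestors in $T$ of $\zeta,\xi$ (a vertex is its own ancestor) and $d(\zeta)=d(\zeta\wedge\zeta)$. $T^2=T\times T$, $\overline{T}^2=\overline{T}\times\overline{T}$, $(\partial T)^2=\partial T\times\partial T$, with product order and topology. For $f:T^2\to[0,\infty)$, $\mathbb{I}f(\alpha)=\sum_{\gamma\in T^2,\gamma\ge\alpha}f(\gamma)$, $\alpha\in\overline{T}^2$. For a Borel measure $\mu\ge0$ on $\overline{T}^2$: $\mathbb{I}^*\mu(\beta)=\mu(\{\alpha\in\overline{T}^2:\alpha\le\beta\})$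 for $\beta\in T^2$, and $\mathbb{V}^\mu=\mathbb{I}(\mathbb{I}^*\mu)$. Capacity: $\mathrm{Cap}(E)=\inf\{\|f\|^2_{\ell^2(T^2)}:f\ge0,\ \mathbb{I}f\ge1\text{ on }E\}$. For a Borel set $E\subseteq\overline{T}^2$ the equilibrium measure $\mu_E$ is the unique Borel measure $\mu_E\ge0$ on $\overline{T}^2$ such that $\mathbb{I}^*\mu_E$ is the extremal function for $\mathrm{Cap}(E)$, i.e. the unique element of minimal norm in the $\ell^2(T^2)$-closure of $\{f\ge0:\mathbb{I}f\ge1\text{ on }E\}$; thus $\mathrm{Cap}(E)=\|\mathbb{I}^*\mu_E\|^2_{\ell^2(T^2)}$. *)

theory Defs
  imports "HOL-Analysis.Analysis"
begin

section \<open>The rooted binary tree and its boundary\<close>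

text \<open>
  A vertex of the infinite rooted binary tree is the list of left/right choices that
  leads to it from the root \<open>[]\<close>; the children of \<open>v\<close> are \<open>v @ [False]\<close> and
  \<open>v @ [True]\<close>. An infinite descending sequence of vertices starting at the root is given by
  its sequence of choices \<open>w\<close>, and \<open>trunc w j\<close> is its vertex of generation \<open>j\<close>.
\<close>

type_synonym vert = "bool list"

datatype ctree = Vertex vert | End "nat \<Rightarrow> bool"

definition trunc :: "(nat \<Rightarrow> bool) \<Rightarrow> nat \<Rightarrow> vert" where
  "trunc w j = map w [0..<j]"

definition boundary :: "ctree set" where
  "boundary = range End"

text \<open>\<open>x \<le> y\<close> means that \<open>y\<close> lies on the path from the root to \<open>x\<close>: the root is the
  largest element.\<close>

instantiation ctree :: ord
begin

fun less_eq_ctree :: "ctree \<Rightarrow> ctree \<Rightarrow> bool" where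
  "Vertex u \<le> Vertex v \<longleftrightarrow> (\<exists>r. u = v @ r)"
| "End w \<le> Vertex v \<longleftrightarrow> (\<exists>j. v = trunc w j)"
| "Vertex u \<le> End w \<longleftrightarrow> False"
| "End w \<le> End w' \<longleftrightarrow> w = w'"

definition less_ctree :: "ctree \<Rightarrow> ctree \<Rightarrow> bool" where
  "less_ctree x y \<longleftrightarrow> x \<le> y \<and> \<not> y \<le> x"

instance ..

end

definition ancestors :: "ctree \<Rightarrow> vert set" where
  "ancestors x = {v. x \<le> Vertex v}"

text \<open>\<open>2\<close> to the power minus the cardinality of a set, which is \<open>0\<close> for infinite sets.\<close>

definition two_pow_neg_card :: "'a set \<Rightarrow> real" where
  "two_pow_neg_card S = (if finite S then (1 / 2) ^ card S else 0)"

definition tree_dist :: "ctree \<Rightarrow> ctree \<Rightarrow> real" where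
  "tree_dist x y = two_pow_neg_card (ancestors x \<inter> ancestors y)
     - (two_pow_neg_card (ancestors x) + two_pow_neg_card (ancestors y)) / 2"

lemma length_trunc [simp]: "length (trunc w j) = j"
  by (simp add: trunc_def)

lemma take_trunc: "take i (trunc w j) = trunc w (min i j)"
  by (rule nth_equalityI) (simp_all add: trunc_def min.commute)

lemma mem_ancestors_Vertex: "v \<in> ancestors (Vertex u) \<longleftrightarrow> take (length v) u = v"
proof
  assume "take (length v) u = v"
  then have "u = v @ drop (length v) u" by (metis append_take_drop_id)
  then show "v \<in> ancestors (Vertex u)" by (simp add: ancestors_def) blast
qed (auto simp: ancestors_def)

lemma mem_ancestors_End: "v \<in> ancestors (End w) \<longleftrightarrow> v = trunc w (length v)"
proof
  assume "v = trunc w (length v)"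
  then show "v \<in> ancestors (End w)" by (simp add: ancestors_def) blast
qed (auto simp: ancestors_def)

lemma ancestors_chain:
  assumes "u \<in> ancestors x" "v \<in> ancestors x" "length u \<le> length v"
  shows "u = take (length u) v"
proof (cases x)
  case (Vertex a)
  with assms(1,2) have "take (length u) a = u" "take (length v) a = v"
    by (simp_all add: mem_ancestors_Vertex)
  then show ?thesis using assms(3) by (metis min.absorb1 take_take)
next
  case (End w)
  with assms(1,2) have "u = trunc w (length u)" "v = trunc w (length v)"
    by (simp_all add: mem_ancestors_End)
  then show ?thesis using assms(3) by (metis min.absorb1 take_trunc)
qed

lemma ancestors_take:
  assumes "v \<in> ancestors x" shows "take i v \<in> ancestors x"
proof (cases x)
  case (Vertex a)
  with assms have "take (length v) a = v" by (simp add: mem_ancestors_Vertex)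
  then have "take i v = take (min i (length v)) a" by (metis take_take)
  then show ?thesis by (metis Vertex mem_ancestors_Vertex append_take_drop_id append_eq_conv_conj)
next
  case (End w)
  with assms have "v = trunc w (length v)" by (simp add: mem_ancestors_End)
  then have "take i v = trunc w (min i (length v))" by (metis take_trunc)
  then show ?thesis using End by (simp add: mem_ancestors_End min.commute)
qed

lemma finite_ancestors_Vertex: "finite (ancestors (Vertex u))"
proof (rule finite_subset)
  show "ancestors (Vertex u) \<subseteq> (\<lambda>i. take i u) ` {..length u}"
  proof
    fix v assume "v \<in> ancestors (Vertex u)"
    then have v: "take (length v) u = v" by (simp add: mem_ancestors_Vertex)
    then have "length v \<le> length u" by (metis length_take min.cobounded1)
    then show "v \<in> (\<lambda>i. take i u) ` {..length u}" using v by (intro image_eqI[of _ _ "length v"]) simp_all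
  qed
qed simp

lemma infinite_ancestors_End: "infinite (ancestors (End w))"
proof
  assume "finite (ancestors (End w))"
  moreover have "range (trunc w) \<subseteq> ancestors (End w)" by (auto simp: mem_ancestors_End)
  ultimately have "finite (range (trunc w))" by (rule rev_finite_subset)
  moreover have "inj (trunc w)" by (rule injI) (metis length_trunc)
  ultimately show False by (simp add: finite_image_iff)
qed

lemma ancestors_inj: assumes A: "ancestors x = ancestors y" shows "x = y"
proof (cases x)
  case x: (Vertex u)
  show ?thesis
  proof (cases y)
    case y: (Vertex v)
    have "u \<in> ancestors x" "v \<in> ancestors y" by (simp_all add: x y mem_ancestors_Vertex)
    then have "u \<in> ancestors y" "v \<in> ancestors x" by (simp_all add: A)
    then have "take (length u) v = u" "take (length v) u = v"
      by (simp_all add: x y mem_ancestors_Vertex)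
    then have "u = v" by (metis length_take min.cobounded1 order_antisym take_all)
    then show ?thesis by (simp add: x y)
  next
    case y: (End w)
    then show ?thesis using A finite_ancestors_Vertex[of u] infinite_ancestors_End[of w] x by simp
  qed
next
  case x: (End w)
  show ?thesis
  proof (cases y)
    case y: (Vertex v)
    then show ?thesis using A finite_ancestors_Vertex[of v] infinite_ancestors_End[of w] x by simp
  next
    case y: (End z)
    have "w i = z i" for i
    proof -
      have "trunc w (Suc i) \<in> ancestors x" by (simp add: x mem_ancestors_End)
      then have "trunc w (Suc i) = trunc z (Suc i)" by (simp add: A y mem_ancestors_End)
      then show ?thesis by (simp add: trunc_def)
    qed
    then show ?thesis by (auto simp: x y)
  qed
qed

lemma two_pow_neg_card_nonneg: "0 \<le> two_pow_neg_card S"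
  by (simp add: two_pow_neg_card_def)

lemma two_pow_neg_card_mono: "S \<subseteq> S' \<Longrightarrow> two_pow_neg_card S' \<le> two_pow_neg_card S"
  by (auto simp: two_pow_neg_card_def card_mono power_decreasing dest: finite_subset)

lemma two_pow_neg_card_eq:
  assumes "two_pow_neg_card (ancestors x \<inter> ancestors y) = two_pow_neg_card (ancestors x)"
  shows "ancestors x \<subseteq> ancestors y"
proof (cases "finite (ancestors x)")
  case True
  then have "card (ancestors x \<inter> ancestors y) = card (ancestors x)"
    using assms by (simp add: two_pow_neg_card_def power_inject_exp')
  then have "ancestors x \<inter> ancestors y = ancestors x"
    using True by (intro card_subset_eq) auto
  then show ?thesis by auto
next
  case False
  then have inf: "infinite (ancestors x \<inter> ancestors y)"
    using assms by (auto simp: two_pow_neg_card_def split: if_splits)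
  show ?thesis
  proof
    fix u assume u: "u \<in> ancestors x"
    have "\<exists>v \<in> ancestors x \<inter> ancestors y. length u \<le> length v"
    proof (rule ccontr)
      assume "\<not> ?thesis"
      then have "ancestors x \<inter> ancestors y \<subseteq> {v. set v \<subseteq> UNIV \<and> length v \<le> length u}"
        by (auto simp: not_le intro: less_imp_le)
      then show False
        using inf finite_lists_length_le[of "UNIV :: bool set" "length u"] finite_subset by auto
    qed
    then obtain v where v: "v \<in> ancestors x" "v \<in> ancestors y" "length u \<le> length v" by auto
    then have "u = take (length u) v" using ancestors_chain u by blast
    then show "u \<in> ancestors y" using ancestors_take v(2) by metis
  qed
qed

lemma ancestors_Int_comparable:
  "ancestors x \<inter> ancestors y \<subseteq> ancestors z \<or> ancestors y \<inter> ancestors z \<subseteq> ancestors x"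
proof (rule ccontr)
  assume "\<not> ?thesis"
  then obtain u v where u: "u \<in> ancestors x" "u \<in> ancestors y" "u \<notin> ancestors z"
    and v: "v \<in> ancestors y" "v \<in> ancestors z" "v \<notin> ancestors x" by blast
  show False
  proof (cases "length u \<le> length v")
    case True
    then show False using ancestors_chain[OF u(2) v(1)] ancestors_take[OF v(2)] u(3) by metis
  next
    case False
    then show False using ancestors_chain[OF v(1) u(2)] ancestors_take[OF u(1)] v(3)
      by (metis nle_le)
  qed
qed

lemma tree_dist_triangle: "tree_dist x z \<le> tree_dist x y + tree_dist y z"
proof -
  let ?w = "two_pow_neg_card" and ?A = ancestors
  have "?w (?A x \<inter> ?A z) + ?w (?A y) \<le> ?w (?A x \<inter> ?A y) + ?w (?A y \<inter> ?A z)"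
    using ancestors_Int_comparable[of x y z]
  proof
    assume "?A x \<inter> ?A y \<subseteq> ?A z"
    then have "?w (?A x \<inter> ?A z) \<le> ?w (?A x \<inter> ?A y)" by (intro two_pow_neg_card_mono) auto
    moreover have "?w (?A y) \<le> ?w (?A y \<inter> ?A z)" by (intro two_pow_neg_card_mono) auto
    ultimately show ?thesis by simp
  next
    assume "?A y \<inter> ?A z \<subseteq> ?A x"
    then have "?w (?A x \<inter> ?A z) \<le> ?w (?A y \<inter> ?A z)" by (intro two_pow_neg_card_mono) auto
    moreover have "?w (?A y) \<le> ?w (?A x \<inter> ?A y)" by (intro two_pow_neg_card_mono) auto
    ultimately show ?thesis by simp
  qed
  then show ?thesis by (simp add: tree_dist_def field_simps)
qed

lemma tree_dist_commute: "tree_dist x y = tree_dist y x"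
  by (simp add: tree_dist_def Int_commute add.commute)

lemma tree_dist_eq_0: "tree_dist x y = 0 \<longleftrightarrow> x = y"
proof
  let ?w = "two_pow_neg_card" and ?A = ancestors
  assume "tree_dist x y = 0"
  moreover have "?w (?A x) \<le> ?w (?A x \<inter> ?A y)" "?w (?A y) \<le> ?w (?A x \<inter> ?A y)"
    by (auto intro: two_pow_neg_card_mono)
  ultimately have "?w (?A x \<inter> ?A y) = ?w (?A x)" "?w (?A y \<inter> ?A x) = ?w (?A y)"
    by (auto simp: tree_dist_def Int_commute field_simps)
  then have "?A x = ?A y" using two_pow_neg_card_eq by blast
  then show "x = y" by (rule ancestors_inj)
qed (simp add: tree_dist_def)

instantiation ctree :: metric_space
begin

definition dist_ctree :: "ctree \<Rightarrow> ctree \<Rightarrow> real" where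
  "dist_ctree = tree_dist"

definition uniformity_ctree :: "(ctree \<times> ctree) filter" where
  "uniformity_ctree = (INF e\<in>{0 <..}. principal {(x, y). dist x y < e})"

definition open_ctree :: "ctree set \<Rightarrow> bool" where
  "open_ctree U = (\<forall>x\<in>U. eventually (\<lambda>(x', y). x' = x \<longrightarrow> y \<in> U) uniformity)"

instance
proof
  show "dist x y = 0 \<longleftrightarrow> x = y" for x y :: ctree
    by (simp add: dist_ctree_def tree_dist_eq_0)
  show "dist x y \<le> dist x z + dist y z" for x y z :: ctree
    using tree_dist_triangle[of x y z] tree_dist_commute[of y z]
    by (simp add: dist_ctree_def)
qed (simp_all add: uniformity_ctree_def open_ctree_def)

end

lemma open_cone: "open {x. x \<le> Vertex v}"
  unfolding open_dist mem_Collect_eq Ball_def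
proof (intro allI impI)
  fix x assume x: "x \<le> Vertex v"
  define p :: real where "p = (1/2) ^ length v"
  define S where "S = (\<lambda>i. take i v) ` {..<length v}"
  let ?w = "two_pow_neg_card" and ?A = ancestors
  have fS: "finite S" by (simp add: S_def)
  have cS: "card S \<le> length v"
    unfolding S_def by (metis card_image_le card_lessThan finite_lessThan)
  have v: "v \<in> ?A x" using x by (simp add: ancestors_def)
  have "card ((\<lambda>i. take i v) ` {..length v}) = Suc (length v)"
    by (subst card_image) (auto simp: inj_on_def dest: arg_cong[where f = length])
  moreover have "(\<lambda>i. take i v) ` {..length v} \<subseteq> ?A x"
    using v ancestors_take by auto
  ultimately have wx: "?w (?A x) \<le> (1/2) ^ Suc (length v)"
    using two_pow_neg_card_mono[of "(\<lambda>i. take i v) ` {..length v}" "?A x"]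
    by (simp add: two_pow_neg_card_def)
  show "\<exists>e>0. \<forall>y. dist y x < e \<longrightarrow> y \<le> Vertex v"
  proof (intro exI[of _ "(1/2) ^ Suc (Suc (length v))"] conjI allI impI)
    fix y assume d: "dist y x < (1/2) ^ Suc (Suc (length v))"
    show "y \<le> Vertex v"
    proof (rule ccontr)
      assume "\<not> y \<le> Vertex v"
      then have vy: "v \<notin> ?A y" by (simp add: ancestors_def)
      have "?A x \<inter> ?A y \<subseteq> S"
      proof
        fix u assume u: "u \<in> ?A x \<inter> ?A y"
        have "length u < length v"
        proof (rule ccontr)
          assume "\<not> ?thesis"
          then have "v = take (length v) u" using ancestors_chain[OF v, of u] u by simp
          then show False using vy u ancestors_take by (metis IntD2)
        qed
        moreover have "u = take (length u) v"
          using ancestors_chain[of u x v] u v calculation by simp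
        ultimately show "u \<in> S" by (auto simp: S_def)
      qed
      then have "?w S \<le> ?w (?A x \<inter> ?A y)" by (rule two_pow_neg_card_mono)
      moreover have "p \<le> ?w S"
        using fS cS by (simp add: p_def two_pow_neg_card_def power_decreasing)
      moreover have "?w (?A y) \<le> ?w (?A x \<inter> ?A y)" by (rule two_pow_neg_card_mono) auto
      moreover have "?w (?A x) \<le> p / 2" using wx by (simp add: p_def)
      moreover have "?w (?A x \<inter> ?A y) - (?w (?A y) + ?w (?A x)) / 2 < p / 4"
        using d by (simp add: dist_ctree_def tree_dist_def Int_commute p_def)
      ultimately show False by argo
    qed
  qed simp
qed

lemma open_singleton_Vertex: "open {Vertex v}"
proof (subst open_dist, safe)
  let ?w = "two_pow_neg_card" and ?A = ancestors
  let ?e = "?w (?A (Vertex v)) / 4"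
  have pos: "0 < ?e" by (simp add: two_pow_neg_card_def finite_ancestors_Vertex)
  have "y = Vertex v" if d: "dist y (Vertex v) < ?e" for y
  proof (rule ccontr)
    assume ne: "y \<noteq> Vertex v"
    have yv: "?w (?A y) \<le> ?w (?A y \<inter> ?A (Vertex v))"
      "?w (?A (Vertex v)) \<le> ?w (?A y \<inter> ?A (Vertex v))"
      by (auto intro: two_pow_neg_card_mono)
    show False
    proof (cases "?A (Vertex v) \<subseteq> ?A y")
      case True
      then have I: "?A y \<inter> ?A (Vertex v) = ?A (Vertex v)" by auto
      have "?A (Vertex v) \<subset> ?A y" using True ne ancestors_inj by blast
      then have "?w (?A y) \<le> ?w (?A (Vertex v)) / 2"
      proof (cases "finite (?A y)")
        case True
        then have "card (?A (Vertex v)) < card (?A y)"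
          using \<open>?A (Vertex v) \<subset> ?A y\<close> psubset_card_mono by blast
        then have "(1/2::real) ^ card (?A y) \<le> (1/2) ^ Suc (card (?A (Vertex v)))"
          by (intro power_decreasing) auto
        then show ?thesis using True by (simp add: two_pow_neg_card_def finite_ancestors_Vertex)
      qed (simp add: two_pow_neg_card_def)
      then show False using d I by (simp add: dist_ctree_def tree_dist_def field_simps)
    next
      case False
      have "?A y \<inter> ?A (Vertex v) \<subset> ?A (Vertex v)" using False by auto
      then have "card (?A y \<inter> ?A (Vertex v)) < card (?A (Vertex v))"
        using finite_ancestors_Vertex psubset_card_mono by blast
      then have "(1/2::real) ^ card (?A (Vertex v)) \<le> (1/2) ^ Suc (card (?A y \<inter> ?A (Vertex v)))"
        by (intro power_decreasing) auto
      then have "?w (?A (Vertex v)) \<le> ?w (?A y \<inter> ?A (Vertex v)) / 2"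
        by (simp add: two_pow_neg_card_def finite_ancestors_Vertex)
      then show False using d yv pos by (simp add: dist_ctree_def tree_dist_def field_simps)
    qed
  qed
  then show "\<exists>e>0. \<forall>y. dist y (Vertex v) < e \<longrightarrow> y \<in> {Vertex v}" using pos by blast
qed

lemma closed_boundary: "closed boundary"
proof -
  have "- boundary = (\<Union>v. {Vertex v})"
    unfolding boundary_def by (auto, metis ctree.exhaust rangeI)
  then show ?thesis unfolding closed_def using open_singleton_Vertex by (metis open_UN)
qed


section \<open>Potentials on the bitree\<close>

text \<open>The order and the topology on pairs are the componentwise order and the product
  topology. Potentials take values in \<open>[0, \<infinity>]\<close>.\<close>

abbreviation embed_pair :: "vert \<times> vert \<Rightarrow> ctree \<times> ctree" where
  "embed_pair \<equiv> map_prod Vertex Vertex"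

definition I_op :: "(vert \<times> vert \<Rightarrow> ennreal) \<Rightarrow> ctree \<times> ctree \<Rightarrow> ennreal" where
  "I_op f a = (\<Sum>\<^sub>\<infinity>c\<in>{c. a \<le> embed_pair c}. f c)"

definition I_star :: "(ctree \<times> ctree) measure \<Rightarrow> vert \<times> vert \<Rightarrow> ennreal" where
  "I_star M b = emeasure M {a. a \<le> embed_pair b}"

definition V_pot :: "(ctree \<times> ctree) measure \<Rightarrow> ctree \<times> ctree \<Rightarrow> ennreal" where
  "V_pot M = I_op (I_star M)"

lemma cone_in_borel: "{a. a \<le> embed_pair b} \<in> sets (borel :: (ctree \<times> ctree) measure)"
proof -
  have "{a. a \<le> embed_pair b} = {x. x \<le> Vertex (fst b)} \<times> {x. x \<le> Vertex (snd b)}"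
    by (auto simp: less_eq_prod_def)
  then show ?thesis by (simp add: open_Times open_cone)
qed

definition supp :: "'a::topological_space measure \<Rightarrow> 'a set" where
  "supp M = {x. \<forall>U. open U \<longrightarrow> x \<in> U \<longrightarrow> emeasure M U > 0}"


section \<open>Equilibrium measures\<close>

definition l2_norm_sq :: "(vert \<times> vert \<Rightarrow> real) \<Rightarrow> ennreal" where
  "l2_norm_sq f = (\<Sum>\<^sub>\<infinity>c. ennreal ((f c)\<^sup>2))"

definition admissible :: "(ctree \<times> ctree) set \<Rightarrow> (vert \<times> vert \<Rightarrow> real) set" where
  "admissible E = {f. (\<forall>c. 0 \<le> f c) \<and> l2_norm_sq f < \<infinity> \<and>
     (\<forall>a\<in>E. 1 \<le> I_op (\<lambda>c. ennreal (f c)) a)}"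

definition capacity :: "(ctree \<times> ctree) set \<Rightarrow> ennreal" where
  "capacity E = (INF f\<in>admissible E. l2_norm_sq f)"

definition l2_closure :: "(vert \<times> vert \<Rightarrow> real) set \<Rightarrow> (vert \<times> vert \<Rightarrow> real) set" where
  "l2_closure A = {f. l2_norm_sq f < \<infinity> \<and> (\<forall>e>0. \<exists>g\<in>A. l2_norm_sq (\<lambda>c. f c - g c) < e)}"

text \<open>\<open>f\<close> is the unique element of minimal norm in the closure of the admissible functions.\<close>

definition extremal :: "(ctree \<times> ctree) set \<Rightarrow> (vert \<times> vert \<Rightarrow> real) \<Rightarrow> bool" where
  "extremal E f \<longleftrightarrow> f \<in> l2_closure (admissible E) \<and>
     (\<forall>g\<in>l2_closure (admissible E). g \<noteq> f \<longrightarrow> l2_norm_sq f < l2_norm_sq g)"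

lemma l2_norm_sq_bound:
  assumes t: "0 < t"
  shows "l2_norm_sq g \<le> ennreal (1 + t) * l2_norm_sq f
           + ennreal (1 + 1 / t) * l2_norm_sq (\<lambda>c. f c - g c)"
proof -
  have scale: "(\<Sum>\<^sub>\<infinity>c. k * h c) = k * (\<Sum>\<^sub>\<infinity>c. h c)" for k :: ennreal and h :: "vert \<times> vert \<Rightarrow> ennreal"
    by (simp add: nonneg_infsum_complete sum_distrib_left[symmetric] SUP_mult_left_ennreal)
  have pw: "(g c)\<^sup>2 \<le> (1 + t) * (f c)\<^sup>2 + (1 + 1 / t) * (f c - g c)\<^sup>2" for c
  proof -
    have "(1 + t) * (f c)\<^sup>2 + (1 + 1 / t) * (f c - g c)\<^sup>2 - (g c)\<^sup>2
        = (t * f c + (f c - g c))\<^sup>2 / t"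
      using t by (simp add: field_simps power2_eq_square)
    moreover have "0 \<le> (t * f c + (f c - g c))\<^sup>2 / t" using t by simp
    ultimately show ?thesis by linarith
  qed
  have "l2_norm_sq g \<le> (\<Sum>\<^sub>\<infinity>c. ennreal (1 + t) * ennreal ((f c)\<^sup>2)
          + ennreal (1 + 1 / t) * ennreal ((f c - g c)\<^sup>2))"
    unfolding l2_norm_sq_def
    using pw t by (intro infsum_mono nonneg_summable_on_complete)
      (simp_all add: ennreal_mult[symmetric] ennreal_plus[symmetric] ennreal_leI del: ennreal_plus)
  also have "\<dots> = ennreal (1 + t) * l2_norm_sq f
      + ennreal (1 + 1 / t) * l2_norm_sq (\<lambda>c. f c - g c)"
    unfolding l2_norm_sq_def by (simp add: infsum_add scale nonneg_summable_on_complete)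
  finally show ?thesis .
qed

lemma extremal_capacity:
  assumes f: "extremal E f"
  shows "l2_norm_sq f = capacity E"
proof (rule antisym)
  show "l2_norm_sq f \<le> capacity E"
    unfolding capacity_def
  proof (rule INF_greatest)
    fix g assume g: "g \<in> admissible E"
    moreover have "l2_norm_sq (\<lambda>c. g c - g c) = 0" by (simp add: l2_norm_sq_def)
    moreover have "l2_norm_sq g < \<infinity>" using g by (simp add: admissible_def)
    ultimately have "g \<in> l2_closure (admissible E)"
      unfolding l2_closure_def by (auto intro!: bexI[of _ g])
    then show "l2_norm_sq f \<le> l2_norm_sq g"
      using f unfolding extremal_def by (cases "g = f") (auto intro: less_imp_le)
  qed
  have fin: "l2_norm_sq f < \<infinity>" using f by (simp add: extremal_def l2_closure_def)
  then obtain F where F: "0 \<le> F" "l2_norm_sq f = ennreal F"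
    by (metis ennreal_cases infinity_ennreal_def less_irrefl)
  show "capacity E \<le> l2_norm_sq f"
  proof (rule ennreal_le_epsilon)
    fix e :: real assume e: "0 < e"
    define t where "t = min 1 (e / (F + 2))"
    have t: "0 < t" "t \<le> 1" using e F by (auto simp: t_def)
    have "t \<le> e / (F + 2)" by (simp add: t_def)
    then have "t * (F + 2) \<le> e" using F by (simp add: pos_le_divide_eq)
    moreover have "t * t \<le> t" using t mult_left_le by simp
    moreover have "(1 + 1 / t) * t\<^sup>2 = t * t + t"
      using t(1) by (simp add: distrib_right power2_eq_square)
    ultimately have b: "(1 + t) * F + (1 + 1 / t) * t\<^sup>2 \<le> F + e"
      by (simp add: algebra_simps)
    have "0 < ennreal (t\<^sup>2)" using t by simp
    then obtain g where g: "g \<in> admissible E" "l2_norm_sq (\<lambda>c. f c - g c) < ennreal (t\<^sup>2)"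
      using f unfolding extremal_def l2_closure_def by blast
    have "capacity E \<le> l2_norm_sq g" unfolding capacity_def using g(1) by (rule INF_lower)
    also have "\<dots> \<le> ennreal (1 + t) * l2_norm_sq f
        + ennreal (1 + 1 / t) * l2_norm_sq (\<lambda>c. f c - g c)"
      using t(1) by (rule l2_norm_sq_bound)
    also have "\<dots> \<le> ennreal (1 + t) * ennreal F + ennreal (1 + 1 / t) * ennreal (t\<^sup>2)"
      using g(2) F by (intro add_mono mult_left_mono) auto
    also have "\<dots> = ennreal ((1 + t) * F + (1 + 1 / t) * t\<^sup>2)"
      using t F by (simp add: ennreal_mult[symmetric] ennreal_plus[symmetric] del: ennreal_plus)
    also have "\<dots> \<le> ennreal (F + e)" using b by (rule ennreal_leI)
    also have "\<dots> = l2_norm_sq f + ennreal e" using F e by simp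
    finally show "capacity E \<le> l2_norm_sq f + ennreal e" .
  qed
qed

text \<open>Such a measure is finite, and it is determined by \<open>E\<close>: the sets \<open>{a. a \<le> embed_pair b}\<close>
  generate the Borel sets and are, up to the empty set, stable under intersection.\<close>

definition equilibrium_measure ::
    "(ctree \<times> ctree) set \<Rightarrow> (ctree \<times> ctree) measure \<Rightarrow> bool" where
  "equilibrium_measure E M \<longleftrightarrow> sets M = sets borel \<and>
     (\<exists>f. extremal E f \<and> (\<forall>b. I_star M b = ennreal (f b)))"

end

theory Submission
  imports Defs "HOL-Probability.Infinite_Product_Measure" "HOL-Probability.Probability_Mass_Function"
begin

text \<open>
  On the boundary of the bitree the potential of a measure has the product kernel
  \<open>d(x \<and> x') * d(y \<and> y')\<close>, where \<open>d\<close> counts common ancestors. The maximum principle fails for it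
  because a point can be close to many mutually distant pieces at once: close to some of them in
  the first coordinate and to the others in the second.

  Let \<open>spine a\<close> be the vertex of generation \<open>a\<close> that follows the leftmost ray for \<open>a - 1\<close> steps and
  then turns right. Given \<open>n\<close>, put \<open>a\<^sub>k = 2\<^bsup>k+1\<^esup>\<close>, \<open>b\<^sub>k = 2\<^bsup>n-k+1\<^esup>\<close> and \<open>N = a\<^sub>k b\<^sub>k = 2\<^bsup>n+2\<^esup>\<close>. Let \<open>E\<close> be
  the union over \<open>k \<le> n\<close> of the boundary pieces below \<open>(spine a\<^sub>k, spine b\<^sub>k)\<close>, and let the measure
  put mass \<open>m\<close>, uniformly distributed, on each piece.

  In one coordinate, the uniform probability below \<open>spine a\<close> has potential \<open>a + 2\<close> at the points
  below \<open>spine a\<close> (\<open>a + 1\<close> from the ancestors of \<open>spine a\<close>, including itself, and \<open>1/2 + 1/4 + ...\<close>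
  from the deeper vertices), potential \<open>min a a'\<close> at the points below \<open>spine a'\<close> with
  \<open>a' \<noteq> a\<close>, and potential \<open>a\<close> at the leftmost end. Hence the potential at a point of the piece \<open>j\<close> is \<open>m\<close> times
  \<open>(\<Sum>k<j. a\<^sub>k b\<^sub>j) + (a\<^sub>j + 2) (b\<^sub>j + 2) + (\<Sum>k>j. a\<^sub>j b\<^sub>k)\<close>,
  that is, \<open>(a\<^sub>j - 2) b\<^sub>j + (a\<^sub>j + 2) (b\<^sub>j + 2) + a\<^sub>j (b\<^sub>j - 2) = 3 N + 4\<close>: what the extreme pieces lose by
  having fewer neighbours, they gain by their larger self-interaction. So for \<open>m = 1 / (3 N + 4)\<close> the
  potential is exactly \<open>1\<close> on \<open>E\<close>, whereas at the pair of leftmost ends every piece contributes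
  \<open>m N\<close>, which gives \<open>m (n + 1) N \<ge> (n + 1) / 4\<close>. The two computations are
  \<open>V_pot_dyadic_piece\<close> and \<open>V_pot_dyadic_corner\<close>.

  A measure concentrated on \<open>E\<close> with potential \<open>1\<close> on \<open>E\<close> is the equilibrium measure of \<open>E\<close>
  (\<open>equilibrium_measure_if_V_pot_eq_1\<close>). Indeed \<open>f = I_star M\<close> is then admissible, and for every
  admissible \<open>h\<close> the inner product of \<open>h\<close> and \<open>f\<close> is the integral of \<open>I_op h\<close>, hence at least the
  total mass, which is the squared norm of \<open>f\<close>.
\<close>

section \<open>Countable sums as integrals\<close>

lemma infsum_eq_nn_integral_count_space:
  fixes f :: "'a \<Rightarrow> ennreal"
  assumes "countable A"
  shows "infsum f A = (\<integral>\<^sup>+x. f x \<partial>count_space A)"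
proof (cases "finite A")
  case True
  then show ?thesis by (simp add: nn_integral_count_space_finite)
next
  case False
  have sup: "infsum f A = (SUP F\<in>{F. finite F \<and> F \<subseteq> A}. sum f F)"
    by (rule nonneg_infsum_complete) simp
  show ?thesis
  proof (rule antisym)
    show "infsum f A \<le> (\<integral>\<^sup>+x. f x \<partial>count_space A)"
      unfolding sup
    proof (rule SUP_least, clarify)
      fix F assume F: "finite F" "F \<subseteq> A"
      have "sum f F = (\<integral>\<^sup>+x. f x \<partial>count_space F)"
        using F by (simp add: nn_integral_count_space_finite)
      also have "\<dots> \<le> (\<integral>\<^sup>+x. f x \<partial>count_space A)"
        using F by (auto simp: nn_integral_count_space_indicator intro!: nn_integral_mono
            split: split_indicator)
      finally show "sum f F \<le> (\<integral>\<^sup>+x. f x \<partial>count_space A)" .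
    qed
  next
    have bij: "bij_betw (from_nat_into A) UNIV A"
      using assms False by (rule bij_betw_from_nat_into)
    have "(\<integral>\<^sup>+x. f x \<partial>count_space A) = (\<Sum>i. f (from_nat_into A i))"
      by (simp add: nn_integral_bij_count_space[OF bij, symmetric] nn_integral_count_space_nat)
    also have "\<dots> = (SUP n. \<Sum>i<n. f (from_nat_into A i))"
      by (rule suminf_eq_SUP)
    also have "\<dots> \<le> infsum f A"
    proof (rule SUP_least)
      fix n
      have "(\<Sum>i<n. f (from_nat_into A i)) = sum f (from_nat_into A ` {..<n})"
        using bij by (subst sum.reindex) (auto simp: bij_betw_def inj_on_def)
      also have "\<dots> \<le> infsum f A"
        unfolding sup using bij by (intro SUP_upper) (auto simp: bij_betw_def)
      finally show "(\<Sum>i<n. f (from_nat_into A i)) \<le> infsum f A" .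
    qed
    finally show "(\<integral>\<^sup>+x. f x \<partial>count_space A) \<le> infsum f A" .
  qed
qed

lemma l2_norm_sq_eq_nn_integral:
  "l2_norm_sq f = (\<integral>\<^sup>+c. ennreal ((f c)\<^sup>2) \<partial>count_space UNIV)"
  unfolding l2_norm_sq_def by (rule infsum_eq_nn_integral_count_space) simp

lemma I_op_eq_nn_integral:
  "I_op f a = (\<integral>\<^sup>+c. f c * indicator {x. x \<le> embed_pair c} a \<partial>count_space UNIV)"
proof -
  have "I_op f a = (\<integral>\<^sup>+c. f c \<partial>count_space {c. a \<le> embed_pair c})"
    unfolding I_op_def by (rule infsum_eq_nn_integral_count_space) simp
  also have "\<dots> = (\<integral>\<^sup>+c. f c * indicator {x. x \<le> embed_pair c} a \<partial>count_space UNIV)"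
    by (subst nn_integral_count_space_indicator)
       (auto intro!: nn_integral_cong split: split_indicator)
  finally show ?thesis .
qed

section \<open>Recognising an equilibrium measure\<close>

text \<open>The operators \<open>I_op\<close> and \<open>I_star\<close> are adjoint, by Tonelli's theorem.\<close>

lemma nn_integral_I_op:
  assumes M: "sets M = sets borel"
  shows "(\<integral>\<^sup>+z. I_op g z \<partial>M) = (\<integral>\<^sup>+c. g c * I_star M c \<partial>count_space UNIV)"
proof -
  have cone: "{x. x \<le> embed_pair c} \<in> sets M" for c
    by (simp add: M cone_in_borel)
  have "(\<integral>\<^sup>+z. I_op g z \<partial>M)
      = (\<integral>\<^sup>+z. \<integral>\<^sup>+c. g c * indicator {x. x \<le> embed_pair c} z \<partial>count_space UNIV \<partial>M)"
    by (simp add: I_op_eq_nn_integral)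
  also have "\<dots> = (\<integral>\<^sup>+c. \<integral>\<^sup>+z. g c * indicator {x. x \<le> embed_pair c} z \<partial>M \<partial>count_space UNIV)"
    by (rule nn_integral_count_space_nn_integral)
       (auto intro!: borel_measurable_times_ennreal borel_measurable_indicator cone)
  also have "\<dots> = (\<integral>\<^sup>+c. g c * I_star M c \<partial>count_space UNIV)"
    by (simp add: nn_integral_cmult_indicator cone I_star_def)
  finally show ?thesis .
qed

lemma point_le_l2_norm_sq: "ennreal ((f c)\<^sup>2) \<le> l2_norm_sq f"
  unfolding l2_norm_sq_eq_nn_integral by (rule nn_integral_ge_point) simp

text \<open>The hypothesis is the Pythagorean form of minimality: the angle at \<open>f\<close> between the
  origin and any admissible function is not acute. It forces admissible functions of almost minimal norm to be close to \<open>f\<close>, so it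
  survives the passage to the closure and gives uniqueness there. Closeness is only tested at one
  point \<open>c\<close> where the competitor \<open>g\<close> differs from \<open>f\<close>.\<close>

lemma extremal_if_gap:
  assumes f: "f \<in> admissible E"
    and gap: "\<And>h. h \<in> admissible E \<Longrightarrow> l2_norm_sq f + l2_norm_sq (\<lambda>c. h c - f c) \<le> l2_norm_sq h"
  shows "extremal E f"
  unfolding extremal_def
proof (intro conjI ballI impI)
  have fin: "l2_norm_sq f < \<infinity>" using f by (simp add: admissible_def)
  have "l2_norm_sq (\<lambda>c. f c - f c) = 0" by (simp add: l2_norm_sq_def)
  then show "f \<in> l2_closure (admissible E)"
    using f fin unfolding l2_closure_def by (auto intro!: bexI[of _ f])
  fix g assume g: "g \<in> l2_closure (admissible E)" "g \<noteq> f"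
  then obtain c where c: "g c \<noteq> f c" by (meson ext)
  define d where "d = (g c - f c)\<^sup>2"
  have d: "0 < d" using c by (simp add: d_def)
  obtain F where F: "0 \<le> F" "l2_norm_sq f = ennreal F"
    using fin by (metis ennreal_cases infinity_ennreal_def less_irrefl)
  show "l2_norm_sq f < l2_norm_sq g"
  proof (rule ccontr)
    assume "\<not> l2_norm_sq f < l2_norm_sq g"
    then have gF: "l2_norm_sq g \<le> ennreal F" using F by simp
    \<comment> \<open>An admissible \<open>h\<close> within distance \<open>t\<close> of \<open>g\<close> would give \<open>d \<le> 2 * t * (F + 3)\<close>; this choice of \<open>t\<close>
      makes the right-hand side at most \<open>d / 2\<close>.\<close>
    define t where "t = min 1 (d / (4 * (F + 3)))"
    have t: "0 < t" "t \<le> 1" using d F by (auto simp: t_def)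
    have "t \<le> d / (4 * (F + 3))" by (simp add: t_def)
    then have td: "t * (4 * (F + 3)) \<le> d" using F by (simp add: pos_le_divide_eq)
    have "0 < ennreal (t\<^sup>2)" using t by simp
    then obtain h where h: "h \<in> admissible E" "l2_norm_sq (\<lambda>c. g c - h c) < ennreal (t\<^sup>2)"
      using g unfolding l2_closure_def by blast
    have "ennreal (F + (h c - f c)\<^sup>2) = l2_norm_sq f + ennreal ((h c - f c)\<^sup>2)"
      using F by simp
    also have "\<dots> \<le> l2_norm_sq f + l2_norm_sq (\<lambda>c. h c - f c)"
      using point_le_l2_norm_sq[of "\<lambda>c. h c - f c" c] by (intro add_left_mono) simp
    also have "\<dots> \<le> l2_norm_sq h" by (rule gap) (rule h)
    also have "\<dots> \<le> ennreal (1 + t) * l2_norm_sq g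
        + ennreal (1 + 1 / t) * l2_norm_sq (\<lambda>c. g c - h c)"
      using t(1) by (rule l2_norm_sq_bound)
    also have "\<dots> \<le> ennreal (1 + t) * ennreal F + ennreal (1 + 1 / t) * ennreal (t\<^sup>2)"
      using h(2) gF by (intro add_mono mult_left_mono) auto
    also have "\<dots> = ennreal ((1 + t) * F + (1 + 1 / t) * t\<^sup>2)"
      using t F by (simp add: ennreal_mult[symmetric] ennreal_plus[symmetric] del: ennreal_plus)
    finally have "F + (h c - f c)\<^sup>2 \<le> (1 + t) * F + (1 + 1 / t) * t\<^sup>2"
      using t F by (subst (asm) ennreal_le_iff) (auto intro!: add_nonneg_nonneg mult_nonneg_nonneg)
    moreover have "(1 + 1 / t) * t\<^sup>2 = t * t + t"
      using t(1) by (simp add: distrib_right power2_eq_square)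
    ultimately have hf: "(h c - f c)\<^sup>2 \<le> t * F + t * t + t" by (simp add: algebra_simps)
    have "ennreal ((g c - h c)\<^sup>2) \<le> ennreal (t\<^sup>2)"
      using point_le_l2_norm_sq[of "\<lambda>c. g c - h c" c] h(2) by (meson le_less_trans less_imp_le)
    then have gh: "(g c - h c)\<^sup>2 \<le> t * t" by (simp add: power2_eq_square)
    have "d \<le> 2 * (g c - h c)\<^sup>2 + 2 * (h c - f c)\<^sup>2"
      using sum_squares_ge_zero[of "g c - h c - (h c - f c)" 0]
      by (simp add: d_def power2_eq_square algebra_simps)
    moreover have "t * t \<le> t" using t mult_left_le by simp
    moreover have "t * (F + 3) = t * F + 3 * t" by (simp add: algebra_simps)
    ultimately show False using gh hf td d by (simp add: algebra_simps) 
  qed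
qed

text \<open>The squared norm of \<open>I_star M\<close> is the integral of the potential, that is, the total mass of
  \<open>M\<close>; the inner product with an admissible function is at least as large. Expanding
  \<open>(h - f)\<^sup>2\<close> turns this into the hypothesis of \<open>extremal_if_gap\<close>.\<close>

lemma equilibrium_measure_if_V_pot_eq_1:
  assumes M: "sets M = sets borel" and fin: "emeasure M UNIV < \<infinity>"
    and conc: "AE z in M. z \<in> E" and one: "\<And>z. z \<in> E \<Longrightarrow> V_pot M z = 1"
  shows "equilibrium_measure E M"
proof -
  have sp: "space M = UNIV" using sets_eq_imp_space_eq[OF M] by simp
  define f where "f c = enn2real (I_star M c)" for c
  have "I_star M c < \<infinity>" for c
    unfolding I_star_def using emeasure_space[of M] fin sp by (metis le_less_trans)
  then have f: "ennreal (f c) = I_star M c" for c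
    by (simp add: f_def)
  have f0: "0 \<le> f c" for c by (simp add: f_def)
  have total: "(\<integral>\<^sup>+z. 1 \<partial>M) = emeasure M UNIV" by (simp add: sp)
  have sq: "ennreal ((f c)\<^sup>2) = I_star M c * I_star M c" for c
    using f0 by (simp add: power2_eq_square ennreal_mult f)
  have "l2_norm_sq f = (\<integral>\<^sup>+z. V_pot M z \<partial>M)"
    unfolding V_pot_def nn_integral_I_op[OF M] l2_norm_sq_eq_nn_integral sq ..
  also have "\<dots> = (\<integral>\<^sup>+z. 1 \<partial>M)"
    using conc one by (intro nn_integral_cong_AE) auto
  finally have norm: "l2_norm_sq f = emeasure M UNIV" using total by simp
  have adm: "f \<in> admissible E"
    using f0 fin one by (simp add: admissible_def norm f V_pot_def)
  have "extremal E f"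
  proof (rule extremal_if_gap[OF adm])
    fix h assume h: "h \<in> admissible E"
    then have h0: "0 \<le> h c" for c unfolding admissible_def by blast
    have "emeasure M UNIV \<le> (\<integral>\<^sup>+z. I_op (\<lambda>c. ennreal (h c)) z \<partial>M)"
      unfolding total[symmetric] using conc h by (intro nn_integral_mono_AE) (auto simp: admissible_def)
    also have "\<dots> = (\<integral>\<^sup>+c. ennreal (h c * f c) \<partial>count_space UNIV)"
      using h0 f0 by (simp add: nn_integral_I_op[OF M] f[symmetric] ennreal_mult)
    finally have pair: "l2_norm_sq f \<le> (\<integral>\<^sup>+c. ennreal (h c * f c) \<partial>count_space UNIV)"
      by (simp add: norm)
    \<comment> \<open>The cross term is kept on the left-hand side of \<open>(h - f)\<^sup>2 + 2 * h * f = h\<^sup>2 + f\<^sup>2\<close>, because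
      subtraction of extended nonnegative reals is truncated.\<close>
    have "l2_norm_sq (\<lambda>c. h c - f c) + (l2_norm_sq f + l2_norm_sq f)
        \<le> l2_norm_sq (\<lambda>c. h c - f c) + ((\<integral>\<^sup>+c. ennreal (h c * f c) \<partial>count_space UNIV)
            + (\<integral>\<^sup>+c. ennreal (h c * f c) \<partial>count_space UNIV))"
      by (intro add_left_mono add_mono pair)
    also have "\<dots> = (\<integral>\<^sup>+c. ennreal ((h c - f c)\<^sup>2) + (ennreal (h c * f c) + ennreal (h c * f c))
        \<partial>count_space UNIV)"
      by (simp add: l2_norm_sq_eq_nn_integral nn_integral_add)
    also have "\<dots> = (\<integral>\<^sup>+c. ennreal ((h c)\<^sup>2) + ennreal ((f c)\<^sup>2) \<partial>count_space UNIV)"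
    proof (rule nn_integral_cong)
      fix c
      have "(h c - f c)\<^sup>2 + (h c * f c + h c * f c) = (h c)\<^sup>2 + (f c)\<^sup>2"
        by (simp add: power2_eq_square algebra_simps)
      then show "ennreal ((h c - f c)\<^sup>2) + (ennreal (h c * f c) + ennreal (h c * f c))
          = ennreal ((h c)\<^sup>2) + ennreal ((f c)\<^sup>2)"
        using h0[of c] f0[of c] by (simp flip: ennreal_plus)
    qed
    also have "\<dots> = l2_norm_sq f + l2_norm_sq h"
      by (simp add: l2_norm_sq_eq_nn_integral nn_integral_add add.commute)
    finally have "l2_norm_sq f + (l2_norm_sq f + l2_norm_sq (\<lambda>c. h c - f c)) \<le> l2_norm_sq f + l2_norm_sq h"
      by (simp add: ac_simps)
    then show "l2_norm_sq f + l2_norm_sq (\<lambda>c. h c - f c) \<le> l2_norm_sq h"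
      using fin norm by (auto simp: ennreal_add_left_cancel_le)
  qed
  then show ?thesis using M f unfolding equilibrium_measure_def by auto
qed

section \<open>The uniform measure on pairs of boundary points\<close>

definition coin :: "(nat \<Rightarrow> bool) measure" where
  "coin = Pi\<^sub>M UNIV (\<lambda>_. measure_pmf (bernoulli_pmf (1 / 2)))"

definition cyl :: "vert \<Rightarrow> (nat \<Rightarrow> bool) set" where
  "cyl v = {w. trunc w (length v) = v}"

interpretation coin: product_prob_space "\<lambda>_. measure_pmf (bernoulli_pmf (1 / 2))" "UNIV :: nat set" ..

lemma space_coin [simp]: "space coin = UNIV"
  by (simp add: coin_def space_PiM)

lemma prob_space_coin: "prob_space coin"
  unfolding coin_def by (intro prob_space_PiM prob_space_measure_pmf)

lemma cyl_eq: "cyl v = {w \<in> space coin. \<forall>i\<in>{..<length v}. w i \<in> {v ! i}}"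
proof -
  have "trunc w (length v) = v \<longleftrightarrow> (\<forall>i<length v. w i = v ! i)" for w
    unfolding trunc_def by (subst list_eq_iff_nth_eq) simp
  then show ?thesis by (auto simp: cyl_def)
qed

lemma cyl_in_sets [measurable]: "cyl v \<in> sets coin"
  unfolding cyl_eq coin_def
  by (intro sets.sets_Collect_finite_All sets_Collect_single') auto

lemma emeasure_coin_cyl: "emeasure coin (cyl v) = ennreal ((1 / 2) ^ length v)"
proof -
  have "emeasure (measure_pmf (bernoulli_pmf (1 / 2))) {b} = ennreal (1 / 2)" for b
    by (cases b) (simp_all add: emeasure_pmf_single)
  then have "emeasure coin (cyl v) = (\<Prod>i\<in>{..<length v}. ennreal (1 / 2))"
    unfolding cyl_eq coin_def by (subst coin.emeasure_PiM_Collect) (simp_all del: prod_constant)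
  also have "\<dots> = ennreal ((1 / 2) ^ length v)"
    by (subst prod_ennreal) simp_all
  finally show ?thesis .
qed

lemma trunc_eq_mono: "trunc w j = trunc w' j \<Longrightarrow> i \<le> j \<Longrightarrow> trunc w i = trunc w' i"
  using take_trunc[of i w j] take_trunc[of i w' j] by simp

lemma End_le_Vertex_iff: "End w \<le> Vertex v \<longleftrightarrow> w \<in> cyl v"
  using mem_ancestors_End[of v w] unfolding ancestors_def cyl_def mem_Collect_eq by (metis (full_types))

lemma cyl_Int:
  assumes "length v \<le> length u"
  shows "cyl v \<inter> cyl u = (if take (length v) u = v then cyl u else {})"
proof -
  have "w \<in> cyl v \<longleftrightarrow> take (length v) u = v" if "w \<in> cyl u" for w
  proof -
    have "take (length v) u = trunc w (length v)"
      using take_trunc[of "length v" w "length u"] that assms by (simp add: cyl_def)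
    then show ?thesis by (simp add: cyl_def)
  qed
  then show ?thesis by auto
qed

text \<open>The ancestors of generation less than \<open>j\<close> are common to both points.\<close>

lemma dist_End_le:
  assumes "trunc w j = trunc w' j"
  shows "dist (End w) (End w') \<le> (1 / 2) ^ j"
proof -
  let ?S = "trunc w ` {..<j}"
  have "?S \<subseteq> ancestors (End w) \<inter> ancestors (End w')"
    using trunc_eq_mono[OF assms] by (auto simp: mem_ancestors_End)
  then have "two_pow_neg_card (ancestors (End w) \<inter> ancestors (End w')) \<le> two_pow_neg_card ?S"
    by (rule two_pow_neg_card_mono)
  also have "card ?S = j"
    by (subst card_image) (auto simp: inj_on_def dest: arg_cong[where f = length])
  then have "two_pow_neg_card ?S = (1 / 2) ^ j" by (simp add: two_pow_neg_card_def)
  finally show ?thesis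
    using two_pow_neg_card_nonneg[of "ancestors (End w)"] two_pow_neg_card_nonneg[of "ancestors (End w')"]
    unfolding dist_ctree_def tree_dist_def by argo
qed

lemma cyl_subset_open:
  assumes "open A" "End w \<in> A"
  obtains j where "\<And>w'. w' \<in> cyl (trunc w j) \<Longrightarrow> End w' \<in> A"
proof -
  obtain e where e: "0 < e" "\<And>y. dist y (End w) < e \<Longrightarrow> y \<in> A"
    using assms by (auto simp: open_dist)
  obtain j where j: "(1 / 2 :: real) ^ j < e"
    using real_arch_pow_inv[OF e(1), of "1/2"] by auto
  show thesis
  proof
    fix w' assume "w' \<in> cyl (trunc w j)"
    then have "trunc w' j = trunc w j" by (simp add: cyl_def)
    from dist_End_le[OF this] j e(2) show "End w' \<in> A" by simp
  qed
qed

text \<open>The preimage of an open set is a union of products of cylinders, and there are only countably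
  many of them.\<close>

lemma measurable_End_pair [measurable]:
  "map_prod End End \<in> coin \<Otimes>\<^sub>M coin \<rightarrow>\<^sub>M (borel :: (ctree \<times> ctree) measure)"
proof (rule borel_measurableI)
  fix W :: "(ctree \<times> ctree) set" assume W: "open W"
  define I where "I = {c. map_prod End End ` (cyl (fst c) \<times> cyl (snd c)) \<subseteq> W}"
  have "map_prod End End -` W = (\<Union>c\<in>I. cyl (fst c) \<times> cyl (snd c))"
  proof (intro equalityI subsetI)
    fix p assume "p \<in> map_prod End End -` W"
    moreover obtain x y where p: "p = (x, y)" by (cases p)
    ultimately have "(End x, End y) \<in> W" by simp
    with W obtain A B where AB: "open A" "open B" "End x \<in> A" "End y \<in> B" "A \<times> B \<subseteq> W"
      by (auto elim: open_prod_elim)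
    obtain i where i: "\<And>w. w \<in> cyl (trunc x i) \<Longrightarrow> End w \<in> A"
      using cyl_subset_open[OF AB(1,3)] by blast
    obtain j where j: "\<And>w. w \<in> cyl (trunc y j) \<Longrightarrow> End w \<in> B"
      using cyl_subset_open[OF AB(2,4)] by blast
    have "(trunc x i, trunc y j) \<in> I" using i j AB(5) by (auto simp: I_def)
    moreover have "p \<in> cyl (trunc x i) \<times> cyl (trunc y j)" by (simp add: p cyl_def)
    ultimately show "p \<in> (\<Union>c\<in>I. cyl (fst c) \<times> cyl (snd c))" by force
  qed (auto simp: I_def)
  also have "\<dots> \<in> sets (coin \<Otimes>\<^sub>M coin)"
    by (intro sets.countable_UN') auto
  finally show "map_prod End End -` W \<inter> space (coin \<Otimes>\<^sub>M coin) \<in> sets (coin \<Otimes>\<^sub>M coin)"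
    by (simp add: space_pair_measure)
qed

definition uniform_boundary :: "(ctree \<times> ctree) measure" where
  "uniform_boundary = distr (coin \<Otimes>\<^sub>M coin) borel (map_prod End End)"

lemma sets_uniform_boundary [simp, measurable_cong]: "sets uniform_boundary = sets borel"
  by (simp add: uniform_boundary_def)

abbreviation cone :: "vert \<times> vert \<Rightarrow> (ctree \<times> ctree) set" where
  "cone b \<equiv> {a. a \<le> embed_pair b}"

lemma emeasure_uniform_boundary_cones:
  "emeasure uniform_boundary (cone b \<inter> cone u)
    = emeasure coin (cyl (fst b) \<inter> cyl (fst u)) * emeasure coin (cyl (snd b) \<inter> cyl (snd u))"
proof -
  interpret prob_space coin by (rule prob_space_coin)
  have "map_prod End End -` (cone b \<inter> cone u) \<inter> space (coin \<Otimes>\<^sub>M coin)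
      = (cyl (fst b) \<inter> cyl (fst u)) \<times> (cyl (snd b) \<inter> cyl (snd u))"
    by (auto simp: space_pair_measure less_eq_prod_def End_le_Vertex_iff simp del: less_eq_ctree.simps(2))
  then show ?thesis
    unfolding uniform_boundary_def
    by (subst emeasure_distr) (auto intro!: sets.Int cone_in_borel emeasure_pair_measure_Times)
qed

lemma AE_uniform_boundary_in_boundary: "AE z in uniform_boundary. z \<in> boundary \<times> boundary"
proof -
  have "boundary \<times> boundary \<in> sets (borel :: (ctree \<times> ctree) measure)"
    by (intro borel_closed closed_Times closed_boundary)
  then have m: "{z \<in> space borel. z \<in> boundary \<times> boundary} \<in> sets (borel :: (ctree \<times> ctree) measure)"
    by simp
  show ?thesis unfolding uniform_boundary_def
    by (subst AE_distr_iff[OF measurable_End_pair m]) (simp add: boundary_def map_prod_def split: prod.split)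
qed

text \<open>The complement of a cone consists of isolated vertices and of the cones of the other vertices
  of the same generation.\<close>

lemma closed_cone: "closed {x. x \<le> Vertex v}"
proof -
  let ?O = "{x. x \<le> Vertex v}"
  have "- ?O = (\<Union>u\<in>{u. \<not> Vertex u \<le> Vertex v}. {Vertex u})
      \<union> (\<Union>u\<in>{u. length u = length v \<and> u \<noteq> v}. {x. x \<le> Vertex u})"
  proof (intro equalityI subsetI)
    fix x assume x: "x \<in> - ?O"
    show "x \<in> (\<Union>u\<in>{u. \<not> Vertex u \<le> Vertex v}. {Vertex u})
      \<union> (\<Union>u\<in>{u. length u = length v \<and> u \<noteq> v}. {x. x \<le> Vertex u})"
    proof (cases x)
      case (End w)
      then show ?thesis using x
        by (intro UnI2 UN_I[of "trunc w (length v)"])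
          (auto simp: End_le_Vertex_iff cyl_def simp del: less_eq_ctree.simps(2))
    qed (use x in auto)
  next
    fix x assume "x \<in> (\<Union>u\<in>{u. \<not> Vertex u \<le> Vertex v}. {Vertex u})
      \<union> (\<Union>u\<in>{u. length u = length v \<and> u \<noteq> v}. {x. x \<le> Vertex u})"
    then show "x \<in> - ?O"
    proof
      assume "x \<in> (\<Union>u\<in>{u. length u = length v \<and> u \<noteq> v}. {x. x \<le> Vertex u})"
      then obtain u where "u \<in> ancestors x" "length u = length v" "u \<noteq> v"
        by (auto simp: ancestors_def)
      then have "v \<notin> ancestors x" using ancestors_chain[of u x v] by auto
      then show ?thesis by (simp add: ancestors_def)
    qed auto
  qed
  then have "open (- ?O)"
    using open_singleton_Vertex open_cone by (auto intro!: open_Un open_UN)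
  then show ?thesis by (simp add: closed_def)
qed

section \<open>The potential of the uniform measure on a cone\<close>

text \<open>The conditional probability of the cylinder of \<open>v\<close> given that of \<open>u\<close>. It is \<open>I_star\<close> of the
  uniform probability below \<open>u\<close>, in one coordinate.\<close>

definition conditional_mass :: "vert \<Rightarrow> vert \<Rightarrow> ennreal" where
  "conditional_mass u v = ennreal (2 ^ length u) * emeasure coin (cyl v \<inter> cyl u)"

lemma conditional_mass_ancestor:
  assumes "length v \<le> length u"
  shows "conditional_mass u v = (if take (length v) u = v then 1 else 0)"
  using assms by (simp add: conditional_mass_def cyl_Int emeasure_coin_cyl flip: ennreal_mult power_mult_distrib)

lemma conditional_mass_descendant:
  assumes "length u \<le> length v"
  shows "conditional_mass u v =
    (if take (length u) v = u then ennreal ((1 / 2) ^ (length v - length u)) else 0)"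
proof -
  have "(2 :: real) ^ length u * (1 / 2) ^ length v = (1 / 2) ^ (length v - length u)"
    using assms by (simp add: power_one_over power_diff field_simps)
  then show ?thesis
    using cyl_Int[OF assms]
    by (simp add: conditional_mass_def Int_commute emeasure_coin_cyl flip: ennreal_mult)
qed

definition cone_potential :: "vert \<Rightarrow> (nat \<Rightarrow> bool) \<Rightarrow> ennreal" where
  "cone_potential u x = (\<Sum>i. conditional_mass u (trunc x i))"

text \<open>The vertices of the ray \<open>x\<close> above \<open>u\<close> contribute \<open>1\<close> each; from \<open>u\<close> on, the contributions
  form a geometric series with sum \<open>2\<close>.\<close>

lemma cone_potential_inside:
  assumes x: "x \<in> cyl u"
  shows "cone_potential u x = ennreal (real (length u) + 2)"
proof -
  let ?l = "length u"
  let ?f = "\<lambda>i. if i < ?l then 1 else (1 / 2 :: real) ^ (i - ?l)"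
  have tu: "trunc x ?l = u" using x by (simp add: cyl_def)
  have "conditional_mass u (trunc x i) = ennreal (?f i)" for i
  proof (cases "i < ?l")
    case True
    then have "take i u = trunc x i" using tu take_trunc[of i x ?l] by simp
    then show ?thesis using True by (simp add: conditional_mass_ancestor)
  next
    case False
    then have "take ?l (trunc x i) = u" using tu take_trunc[of ?l x i] by simp
    then show ?thesis using False by (simp add: conditional_mass_descendant)
  qed
  then have "cone_potential u x = (\<Sum>i. ennreal (?f i))" by (simp add: cone_potential_def)
  also have "\<dots> = ennreal (2 + real ?l)"
  proof (rule suminf_ennreal_eq)
    have "(\<lambda>i. ?f (i + ?l)) sums (2 :: real)"
      using geometric_sums[of "1 / 2 :: real"] by simp
    then have "?f sums (2 + (\<Sum>i<?l. ?f i))" by (rule sums_iff_shift[THEN iffD1])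
    then show "?f sums (2 + real ?l)" by simp
  qed simp
  finally show ?thesis by (simp add: add.commute)
qed

text \<open>Only the common ancestors of \<open>x\<close> and \<open>u\<close> contribute, with \<open>1\<close> each. There are \<open>d + 1\<close> of
  them when the first disagreement is at position \<open>d\<close>, as the root is one of them.\<close>

lemma cone_potential_outside:
  assumes d: "d < length u" and agree: "\<And>i. i < d \<Longrightarrow> x i = u ! i" and ne: "x d \<noteq> u ! d"
  shows "cone_potential u x = ennreal (real d + 1)"
proof -
  have "conditional_mass u (trunc x i) = (if i \<le> d then 1 else 0)" for i
  proof (cases "i \<le> d")
    case True
    then have "take i u = trunc x i"
      using d agree by (intro nth_equalityI) (auto simp: trunc_def)
    then show ?thesis using True d by (simp add: conditional_mass_ancestor)
  next
    case False
    have tne: "take j u \<noteq> take j (trunc x i)" if "d < j" "j \<le> i" for j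
    proof
      assume "take j u = take j (trunc x i)"
      then have "take j u ! d = take j (trunc x i) ! d" by simp
      then show False using that ne by (simp add: trunc_def)
    qed
    show ?thesis
    proof (cases "i \<le> length u")
      case True
      then show ?thesis using tne[of i] False by (simp add: conditional_mass_ancestor)
    next
      case F: False
      then show ?thesis using tne[of "length u"] False d by (auto simp: conditional_mass_descendant)
    qed
  qed
  then have "cone_potential u x = (\<Sum>i. if i \<le> d then 1 else 0)" by (simp add: cone_potential_def)
  also have "\<dots> = (\<Sum>i\<le>d. if i \<le> d then 1 else (0 :: ennreal))"
    by (rule suminf_finite) auto
  also have "\<dots> = ennreal (real d + 1)" by (simp add: ennreal_plus ennreal_of_nat_eq_real_of_nat add.commute)
  finally show ?thesis .
qed

definition spine :: "nat \<Rightarrow> vert" where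
  "spine a = replicate (a - 1) False @ [True]"

lemma length_spine: "0 < a \<Longrightarrow> length (spine a) = a"
  by (simp add: spine_def)

lemma nth_spine: "i < a \<Longrightarrow> spine a ! i \<longleftrightarrow> Suc i = a"
  by (auto simp: spine_def nth_append)

lemma mem_cyl_spine_nth: "0 < a \<Longrightarrow> x \<in> cyl (spine a) \<Longrightarrow> i < a \<Longrightarrow> x i \<longleftrightarrow> Suc i = a"
  by (auto simp: cyl_eq length_spine nth_spine)

lemma cone_potential_spine_other:
  assumes a: "0 < a" and b: "0 < b" and ab: "a \<noteq> b" and x: "x \<in> cyl (spine a)"
  shows "cone_potential (spine b) x = ennreal (real (min a b))"
proof -
  have "cone_potential (spine b) x = ennreal (real (min a b - 1) + 1)"
  proof (rule cone_potential_outside)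
    show "min a b - 1 < length (spine b)" using a b by (simp add: length_spine)
    show "x i = spine b ! i" if "i < min a b - 1" for i
      using that mem_cyl_spine_nth[OF a x, of i] nth_spine[of i b] by auto
    show "x (min a b - 1) \<noteq> spine b ! (min a b - 1)"
    proof (cases "a < b")
      case True
      then show ?thesis
        using a mem_cyl_spine_nth[OF a x, of "a - 1"] nth_spine[of "a - 1" b] by simp
    next
      case False
      then show ?thesis
        using b ab mem_cyl_spine_nth[OF a x, of "b - 1"] nth_spine[of "b - 1" b] by simp
    qed
  qed
  also have "real (min a b - 1) + 1 = real (min a b)" using a b by simp
  finally show ?thesis .
qed

lemma cone_potential_spine_zero:
  assumes b: "0 < b"
  shows "cone_potential (spine b) (\<lambda>_. False) = ennreal (real b)"
proof -
  have "cone_potential (spine b) (\<lambda>_. False) = ennreal (real (b - 1) + 1)"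
    using b by (intro cone_potential_outside) (auto simp: length_spine nth_spine)
  then show ?thesis using b by simp
qed

section \<open>Mixtures of uniform measures on cones\<close>

definition mixture_density ::
    "real \<Rightarrow> nat \<Rightarrow> (nat \<Rightarrow> vert \<times> vert) \<Rightarrow> ctree \<times> ctree \<Rightarrow> ennreal" where
  "mixture_density m n U z =
     (\<Sum>k\<le>n. ennreal (m * 2 ^ (length (fst (U k)) + length (snd (U k)))) * indicator (cone (U k)) z)"

text \<open>Under the uniform measure the cone of \<open>(u, v)\<close> has mass \<open>2\<close> to the power
  \<open>- (length u + length v)\<close>. The weights cancel this factor, so that each cone contributes \<open>m\<close>
  times the uniform probability on it.\<close>

definition mixture :: "real \<Rightarrow> nat \<Rightarrow> (nat \<Rightarrow> vert \<times> vert) \<Rightarrow> (ctree \<times> ctree) measure" where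
  "mixture m n U = density uniform_boundary (mixture_density m n U)"

lemma sets_mixture: "sets (mixture m n U) = sets borel"
  by (simp add: mixture_def)

lemma mixture_density_measurable: "mixture_density m n U \<in> borel_measurable uniform_boundary"
  unfolding mixture_density_def using cone_in_borel
  by (intro borel_measurable_sum borel_measurable_times_ennreal) auto

lemma I_star_mixture:
  assumes m: "0 \<le> m"
  shows "I_star (mixture m n U) b
    = (\<Sum>k\<le>n. ennreal m *
        (conditional_mass (fst (U k)) (fst b) * conditional_mass (snd (U k)) (snd b)))"
proof -
  let ?w = "\<lambda>k. ennreal (m * 2 ^ (length (fst (U k)) + length (snd (U k))))"
  have cone: "cone c \<in> sets uniform_boundary" for c using cone_in_borel by simp
  have "I_star (mixture m n U) b
      = (\<integral>\<^sup>+z. (\<Sum>k\<le>n. ?w k * indicator (cone (U k)) z) * indicator (cone b) z \<partial>uniform_boundary)"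
    unfolding I_star_def mixture_def mixture_density_def[symmetric]
    by (rule emeasure_density[OF mixture_density_measurable cone])
  also have "\<dots> = (\<integral>\<^sup>+z. (\<Sum>k\<le>n. ?w k * indicator (cone b \<inter> cone (U k)) z) \<partial>uniform_boundary)"
    unfolding sum_distrib_right
    by (intro nn_integral_cong sum.cong refl) (auto split: split_indicator)
  also have "\<dots> = (\<Sum>k\<le>n. \<integral>\<^sup>+z. ?w k * indicator (cone b \<inter> cone (U k)) z \<partial>uniform_boundary)"
    by (intro nn_integral_sum borel_measurable_times_ennreal borel_measurable_indicator
        borel_measurable_const sets.Int cone)
  also have "\<dots> = (\<Sum>k\<le>n. ?w k * emeasure uniform_boundary (cone b \<inter> cone (U k)))"
    by (intro sum.cong refl nn_integral_cmult_indicator sets.Int cone)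
  also have "\<dots> = (\<Sum>k\<le>n. ennreal m *
      (conditional_mass (fst (U k)) (fst b) * conditional_mass (snd (U k)) (snd b)))"
    using m by (simp add: emeasure_uniform_boundary_cones conditional_mass_def power_add ennreal_mult mult_ac)
  finally show ?thesis .
qed

text \<open>The vertex pairs above \<open>(x, y)\<close> form a product of two rays, and \<open>I_star\<close> of each component
  is a product, so the double sum factorises.\<close>

lemma V_pot_mixture:
  assumes m: "0 \<le> m"
  shows "V_pot (mixture m n U) (End x, End y)
    = (\<Sum>k\<le>n. ennreal m * (cone_potential (fst (U k)) x * cone_potential (snd (U k)) y))"
proof -
  let ?g = "\<lambda>k i j. ennreal m *
    (conditional_mass (fst (U k)) (trunc x i) * conditional_mass (snd (U k)) (trunc y j))"
  have trunc_inj: "trunc w i = trunc w j \<longleftrightarrow> i = j" for w i j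
    by (metis length_trunc)
  have bij: "bij_betw (\<lambda>(i, j). (trunc x i, trunc y j)) UNIV {c. (End x, End y) \<le> embed_pair c}"
    unfolding bij_betw_def inj_on_def by (auto simp: trunc_inj less_eq_prod_def image_iff)
  have "V_pot (mixture m n U) (End x, End y)
      = (\<integral>\<^sup>+c. I_star (mixture m n U) c \<partial>count_space {c. (End x, End y) \<le> embed_pair c})"
    unfolding V_pot_def I_op_def by (rule infsum_eq_nn_integral_count_space) simp
  also have "\<dots> = (\<integral>\<^sup>+(i, j). (\<Sum>k\<le>n. ?g k i j) \<partial>count_space UNIV)"
    unfolding nn_integral_bij_count_space[OF bij, symmetric]
    by (simp add: I_star_mixture[OF m] case_prod_unfold)
  also have "\<dots> = (\<integral>\<^sup>+i. \<integral>\<^sup>+j. (\<Sum>k\<le>n. ?g k i j) \<partial>count_space UNIV \<partial>count_space UNIV)"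
    using nn_integral_fst_count_space[of "\<lambda>(i, j). (\<Sum>k\<le>n. ?g k i j)"] by simp
  also have "\<dots> = (\<Sum>k\<le>n. \<integral>\<^sup>+i. \<integral>\<^sup>+j. ?g k i j \<partial>count_space UNIV \<partial>count_space UNIV)"
    by (simp add: nn_integral_sum)
  also have "\<dots> = (\<Sum>k\<le>n. ennreal m * (cone_potential (fst (U k)) x * cone_potential (snd (U k)) y))"
    by (simp add: nn_integral_cmult nn_integral_multc nn_integral_count_space_nat cone_potential_def
        flip: mult.assoc)
  finally show ?thesis .
qed

definition pieces :: "nat \<Rightarrow> (nat \<Rightarrow> vert \<times> vert) \<Rightarrow> (ctree \<times> ctree) set" where
  "pieces n U = boundary \<times> boundary \<inter> (\<Union>k\<le>n. cone (U k))"

lemma closed_pieces: "closed (pieces n U)"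
proof -
  have "cone b = {x. x \<le> Vertex (fst b)} \<times> {x. x \<le> Vertex (snd b)}" for b
    by (auto simp: less_eq_prod_def)
  then show ?thesis
    unfolding pieces_def
    by (auto intro!: closed_Int closed_Times closed_boundary closed_UN closed_cone)
qed

lemma AE_mixture_pieces: "AE z in mixture m n U. z \<in> pieces n U"
  unfolding mixture_def
proof (subst AE_density[OF mixture_density_measurable],
    use AE_uniform_boundary_in_boundary in eventually_elim, rule impI)
  fix z assume z: "z \<in> boundary \<times> boundary" and pos: "0 < mixture_density m n U z"
  have "\<exists>k\<le>n. z \<in> cone (U k)"
  proof (rule ccontr)
    assume "\<not> ?thesis"
    then have "mixture_density m n U z = 0"
      unfolding mixture_density_def by (intro sum.neutral) (auto simp: indicator_def)
    with pos show False by simp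
  qed
  then show "z \<in> pieces n U" using z by (auto simp: pieces_def)
qed

lemma supp_subset_closed:
  assumes M: "sets M = sets borel" and C: "closed C" and AE: "AE z in M. z \<in> C"
  shows "supp M \<subseteq> C"
proof
  fix x assume x: "x \<in> supp M"
  have "- C \<in> sets M" using C M by (simp add: open_Compl)
  moreover have "{z \<in> space M. \<not> z \<in> C} = - C"
    using sets_eq_imp_space_eq[OF M] by auto
  ultimately have "emeasure M (- C) = 0" using AE by (simp add: AE_iff_measurable[of "- C"])
  then show "x \<in> C" using x C unfolding supp_def by (auto simp: open_Compl)
qed

text \<open>The whole boundary lies below the root, so the total mass is \<open>I_star\<close> at the root pair.\<close>

lemma emeasure_mixture_finite:
  assumes m: "0 \<le> m"
  shows "emeasure (mixture m n U) UNIV < \<infinity>"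
proof -
  have "pieces n U \<subseteq> cone ([], [])"
    by (auto simp: pieces_def boundary_def less_eq_prod_def trunc_def)
  then have "AE z in mixture m n U. z \<in> cone ([], [])"
    using AE_mixture_pieces[of n U m] by (auto elim: eventually_mono)
  then have "emeasure (mixture m n U) UNIV = I_star (mixture m n U) ([], [])"
    unfolding I_star_def using cone_in_borel
    by (intro emeasure_eq_AE) (auto simp: sets_mixture)
  also have "\<dots> < \<infinity>"
    unfolding I_star_mixture[OF m]
    by (simp add: conditional_mass_ancestor ennreal_mult_less_top of_nat_less_top)
  finally show ?thesis .
qed

section \<open>A hyperbolic family of dyadic cones\<close>

text \<open>The product of the two generations is \<open>2 ^ (n + 2)\<close> for every \<open>k \<le> n\<close>. The exponents start
  at \<open>1\<close> because the partial sums of \<open>2 + 4 + 8 + ...\<close> fall short of the next term by exactly \<open>2\<close>,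
  the surplus in the one-coordinate self-interaction \<open>a + 2\<close>.\<close>

definition dyadic_pair :: "nat \<Rightarrow> nat \<Rightarrow> vert \<times> vert" where
  "dyadic_pair n k = (spine (2 ^ (k + 1)), spine (2 ^ (n - k + 1)))"

lemma sum_pow2: "(\<Sum>k<j. (2 :: real) ^ (k + 1)) = 2 ^ (j + 1) - 2"
  by (induction j) auto

text \<open>The sum does not depend on \<open>j\<close>; this makes equal masses on the pieces an exact equilibrium.\<close>

lemma sum_dyadic:
  assumes "j \<le> n"
  shows "(\<Sum>k\<le>n. (if k = j then 2 ^ (j + 1) + 2 else 2 ^ (min j k + 1))
      * (if k = j then 2 ^ (n - j + 1) + 2 else 2 ^ (min (n - j) (n - k) + 1)))
    = (3 * 2 ^ (n + 2) + 4 :: real)" (is "(\<Sum>k\<le>n. ?p k * ?q k) = _")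
proof -
  let ?a = "2 ^ (j + 1) :: real" and ?b = "2 ^ (n - j + 1) :: real"
  have split: "{..n} = {..<j} \<union> {j} \<union> {j<..n}" using assms by auto
  have "(\<Sum>k<j. ?p k * ?q k) = (\<Sum>k<j. 2 ^ (k + 1) * ?b)"
    using assms by (intro sum.cong) auto
  also have "\<dots> = (?a - 2) * ?b" by (simp only: sum_pow2 flip: sum_distrib_right)
  finally have lo: "(\<Sum>k<j. ?p k * ?q k) = (?a - 2) * ?b" .
  have "(\<Sum>k\<in>{j<..n}. ?p k * ?q k) = (\<Sum>k\<in>{j<..n}. ?a * 2 ^ (n - k + 1))"
    using assms by (intro sum.cong) auto
  also have "\<dots> = (\<Sum>i<n - j. ?a * 2 ^ (i + 1))"
    using assms
    by (intro sum.reindex_bij_witness[of _ "\<lambda>i. n - i" "\<lambda>k. n - k"]) auto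
  also have "\<dots> = ?a * (?b - 2)" by (simp only: sum_pow2 flip: sum_distrib_left)
  finally have hi: "(\<Sum>k\<in>{j<..n}. ?p k * ?q k) = ?a * (?b - 2)" .
  have "(\<Sum>k\<le>n. ?p k * ?q k) = (?a - 2) * ?b + (?a + 2) * (?b + 2) + ?a * (?b - 2)"
    unfolding split using lo hi by (subst sum.union_disjoint; force?)+
  also have "\<dots> = 3 * (?a * ?b) + 4" by (simp add: algebra_simps)
  also have "?a * ?b = 2 ^ (n + 2)"
    using assms by (simp flip: power_add)
  finally show ?thesis .
qed

lemma V_pot_dyadic_piece:
  assumes m: "0 \<le> m" and z: "z \<in> pieces n (dyadic_pair n)"
  shows "V_pot (mixture m n (dyadic_pair n)) z = ennreal (m * (3 * 2 ^ (n + 2) + 4))"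
proof -
  from z obtain x y j where zxy: "z = (End x, End y)" and j: "j \<le> n"
    and x: "x \<in> cyl (spine (2 ^ (j + 1)))" and y: "y \<in> cyl (spine (2 ^ (n - j + 1)))"
    by (auto simp: pieces_def boundary_def dyadic_pair_def less_eq_prod_def End_le_Vertex_iff
        simp del: less_eq_ctree.simps(2))
  let ?p = "\<lambda>k. if k = j then 2 ^ (j + 1) + 2 else 2 ^ (min j k + 1) :: real"
  let ?q = "\<lambda>k. if k = j then 2 ^ (n - j + 1) + 2 else 2 ^ (min (n - j) (n - k) + 1) :: real"
  have min_pow: "min (2 ^ Suc i) (2 ^ Suc l) = (2 ^ Suc (min i l) :: nat)" for i l
    by (simp add: min_def)
  have px: "cone_potential (spine (2 ^ (k + 1))) x = ennreal (?p k)" for k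
    using cone_potential_inside[OF x] cone_potential_spine_other[OF _ _ _ x, of "2 ^ (k + 1)"]
    by (auto simp: length_spine min_pow simp del: power_Suc)
  have qy: "cone_potential (spine (2 ^ (n - k + 1))) y = ennreal (?q k)" if "k \<le> n" for k
    using cone_potential_inside[OF y] cone_potential_spine_other[OF _ _ _ y, of "2 ^ (n - k + 1)"] that j
    by (auto simp: length_spine min_pow simp del: power_Suc)
  have "V_pot (mixture m n (dyadic_pair n)) z
      = (\<Sum>k\<le>n. ennreal m *
          (cone_potential (spine (2 ^ (k + 1))) x * cone_potential (spine (2 ^ (n - k + 1))) y))"
    by (simp add: zxy V_pot_mixture[OF m] dyadic_pair_def)
  also have "\<dots> = (\<Sum>k\<le>n. ennreal (m * (?p k * ?q k)))"
  proof (intro sum.cong refl)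
    fix k assume "k \<in> {..n}"
    then have k: "k \<le> n" by simp
    have "0 \<le> ?p k" "0 \<le> ?q k" by simp_all
    then show "ennreal m * (cone_potential (spine (2 ^ (k + 1))) x * cone_potential (spine (2 ^ (n - k + 1))) y)
        = ennreal (m * (?p k * ?q k))"
      unfolding px qy[OF k] using m by (simp only: ennreal_mult mult_nonneg_nonneg)
  qed
  also have "\<dots> = ennreal (m * (\<Sum>k\<le>n. ?p k * ?q k))"
    using m by (subst sum_ennreal) (auto simp: sum_distrib_left intro!: mult_nonneg_nonneg)
  finally show ?thesis by (simp only: sum_dyadic[OF j])
qed

lemma V_pot_dyadic_corner:
  assumes m: "0 \<le> m"
  shows "V_pot (mixture m n (dyadic_pair n)) (End (\<lambda>_. False), End (\<lambda>_. False))
    = ennreal (m * ((real n + 1) * 2 ^ (n + 2)))"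
proof -
  have "V_pot (mixture m n (dyadic_pair n)) (End (\<lambda>_. False), End (\<lambda>_. False))
      = (\<Sum>k\<le>n. ennreal (m * 2 ^ (n + 2)))"
    unfolding V_pot_mixture[OF m]
  proof (intro sum.cong refl)
    fix k assume "k \<in> {..n}"
    then have "(2 :: real) ^ (k + 1) * 2 ^ (n - k + 1) = 2 ^ (n + 2)" by (simp flip: power_add)
    then show "ennreal m * (cone_potential (fst (dyadic_pair n k)) (\<lambda>_. False)
          * cone_potential (snd (dyadic_pair n k)) (\<lambda>_. False))
        = ennreal (m * 2 ^ (n + 2))"
      using m by (simp add: dyadic_pair_def cone_potential_spine_zero flip: ennreal_mult del: power_Suc)
  qed
  also have "\<dots> = ennreal (m * ((real n + 1) * 2 ^ (n + 2)))"
    using m by (subst sum_ennreal) (auto simp: algebra_simps)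
  finally show ?thesis .
qed

theorem proposition1p1:
  fixes lam :: real
  assumes "lam \<ge> 1"
  shows "\<exists>(M :: (ctree \<times> ctree) measure) E.
           sets M = sets borel \<and> (AE z in M. z \<in> boundary \<times> boundary) \<and>
           (\<forall>z\<in>supp M. V_pot M z \<le> 1) \<and>
           (\<exists>z0\<in>boundary \<times> boundary. ennreal lam \<le> V_pot M z0) \<and>
           E \<in> sets borel \<and> E \<subseteq> boundary \<times> boundary \<and> equilibrium_measure E M"
proof -
  obtain n :: nat where n: "4 * lam \<le> real n" using real_arch_simple by blast
  define m where "m = 1 / (3 * 2 ^ (n + 2) + 4 :: real)"
  define M where "M = mixture m n (dyadic_pair n)"
  define E where "E = pieces n (dyadic_pair n)"
  have den: "(0 :: real) < 3 * 2 ^ (n + 2) + 4" by (intro add_pos_pos mult_pos_pos) auto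
  have m: "0 \<le> m" using den by (simp add: m_def)
  have M: "sets M = sets borel" by (simp add: M_def sets_mixture)
  have AE: "AE z in M. z \<in> E" unfolding M_def E_def by (rule AE_mixture_pieces)
  have E: "closed E" "E \<subseteq> boundary \<times> boundary"
    unfolding E_def by (rule closed_pieces) (auto simp: pieces_def)
  have one: "V_pot M z = 1" if "z \<in> E" for z
    using V_pot_dyadic_piece[OF m that[unfolded E_def]] den by (simp add: M_def m_def)
  have eq: "equilibrium_measure E M"
    using M _ AE one by (rule equilibrium_measure_if_V_pot_eq_1)
      (simp add: M_def emeasure_mixture_finite[OF m, simplified])
  have "supp M \<subseteq> E" using M E(1) AE by (rule supp_subset_closed)
  moreover have "lam \<le> m * ((real n + 1) * 2 ^ (n + 2))"
  proof -
    have p: "(4 :: real) \<le> 2 ^ (n + 2)" by simp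
    have "lam * (3 * 2 ^ (n + 2) + 4) \<le> lam * (4 * 2 ^ (n + 2))"
      using assms p by (intro mult_left_mono) auto
    also have "\<dots> \<le> (real n + 1) * 2 ^ (n + 2)"
      using n by (simp add: mult.assoc[symmetric] mult_right_mono)
    finally show ?thesis using den by (simp add: m_def pos_le_divide_eq)
  qed
  then have "ennreal lam \<le> V_pot M (End (\<lambda>_. False), End (\<lambda>_. False))"
    unfolding M_def V_pot_dyadic_corner[OF m] by (rule ennreal_leI)
  moreover have "AE z in M. z \<in> boundary \<times> boundary"
    using AE E(2) by (auto elim: eventually_mono)
  ultimately show ?thesis
    using M E eq one
    by (intro exI[of _ M] exI[of _ E])
       (auto simp: boundary_def intro!: bexI[of _ "(End (\<lambda>_. False), End (\<lambda>_. False))"] borel_closed)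
qed

end
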